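(* Let $k$ be a field, $S=k[x_1,\ldots,x_n]$, and let $M=(m_1,\ldots,m_q)$ be a nonzero proper ideal of $S$ generated by monomials $m_1,\ldots,m_q$. Then the Taylor resolution $\mathbb{T}_M$ (on $m_1,\ldots,m_q$) is a minimal free resolution of $S/M$ if and only if $\operatorname{odom}(S/M)=q$.
   Context: Taylor resolution: $\mathbb{T}_M$ has as basis, in homological degree $s$ ($0\le s\le q$), the Taylor symbols $[m_{i_1},\ldots,m_{i_s}]$ for $1\le i_1<\cdots<i_s\le q$ (with $[\varnothing]$ in degree $0$), and differential $$[m_{i_1},\ldots,m_{i_s}]\mapsto\sum_{j=1}^s(-1)^{j+1}\frac{\operatorname{lcm}(m_{i_1},\ldots,m_{i_s})}{\operatorname{lcm}(m_{i_1},\ldots,\widehat{m_{i_j}},\ldots,m_{i_s})}[m_{i_1},\ldots,\widehat{m_{i_j}},\ldots,m_{i_s}].$$ It is a free resolution of $S/M$. A free resolution is minimal if none of its differential matrices has an invertible entry. Dominance: if $L$ is a finite set of monomials, $m\in L$ is dominant (in $L$) in the variable $x$ if for every $m'\in L\setminus\{m\}$ the exponent of $x$ in $m$ is strictly larger than the exponent of $x$ in $m'$. $L$ is a dominant set if each of its elements is dominant in some variable. Order of dominance: let $G$ be the minimal monomial generating set of $M$. Let $\mathscr{I}$ be the class of all sequences $1\le i_1<\cdots<i_r\le n$ with $r\ge 1$ for which $G$ contains a dominant set $D=\{d_1,\ldots,d_r\}$ of cardinality $r$ such that (1) each $d_j$ is dominant (in $D$) in $x_{i_j}$, and (2) writing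 $\operatorname{lcm}(D)=x_1^{\alpha_1}\cdots x_n^{\alpha_n}$, every $m\in G$ dividing $\operatorname{lcm}(D)$ is divisible by at least one of $x_{i_1}^{\alpha_{i_1}},\ldots,x_{i_r}^{\alpha_{i_r}}$. Then $\operatorname{odom}(S/M)$ is the maximum length $r$ of a sequence in $\mathscr{I}$. *)

theory Defs
  imports Complex_Main "HOL-Library.Poly_Mapping"
begin

text \<open>
  Monomials in the variables of the finite linearly ordered type \<open>'x\<close> are identified with their
  exponent vectors, so that the product of monomials is \<open>+\<close> and an exact quotient is \<open>-\<close>.
  With \<open>n = CARD('x)\<close>, the type \<open>('x, 'k) mpoly\<close> is the polynomial ring in \<open>n\<close> variables over
  \<open>'k\<close>, and the order of \<open>'x\<close> is the numbering of the variables. The order \<open>\<le>\<close> which the library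
  puts on exponent vectors is lexicographic and is not divisibility.
\<close>

type_synonym 'x mon = "'x \<Rightarrow>\<^sub>0 nat"

type_synonym ('x, 'k) mpoly = "'x mon \<Rightarrow>\<^sub>0 'k"

definition monom :: "'x mon \<Rightarrow> ('x, 'k::field) mpoly" where
  "monom a = Poly_Mapping.single a 1"

definition mon_dvd :: "'x mon \<Rightarrow> 'x mon \<Rightarrow> bool" where
  "mon_dvd a b \<longleftrightarrow> (\<exists>c. b = a + c)"

text \<open>The \<open>0\<close> inserted below makes the lcm of the empty set equal to the monomial \<open>1\<close>.\<close>

definition mon_lcm :: "'x::finite mon set \<Rightarrow> 'x mon" where
  "mon_lcm A = Abs_poly_mapping (\<lambda>x. Max (insert 0 ((\<lambda>a. Poly_Mapping.lookup a x) ` A)))"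

lemma lookup_mon_lcm:
  "Poly_Mapping.lookup (mon_lcm A) x = Max (insert 0 ((\<lambda>a. Poly_Mapping.lookup a x) ` A))"
  by (simp add: mon_lcm_def)

definition ideal_gen :: "'r::comm_ring_1 set \<Rightarrow> 'r set" where
  "ideal_gen B = module.span (*) B"


subsection \<open>Free resolutions of cyclic modules\<close>

text \<open>
  A sequence of based free modules: \<open>basis C s\<close> is the basis in homological degree \<open>s\<close>,
  \<open>bd C s b\<close> is the image in degree \<open>s - 1\<close> of the basis element \<open>b\<close> of degree \<open>s \<ge> 1\<close>, so that
  \<open>lookup (bd C s b) c\<close> is the entry of the differential matrix in row \<open>c\<close> and column \<open>b\<close>, and
  \<open>aug C b\<close> is a representative of the image of the basis element \<open>b\<close> of degree \<open>0\<close>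
  in the quotient ring that is resolved.
\<close>

record (overloaded) ('b, 'r) based_complex =
  basis :: "nat \<Rightarrow> 'b set"
  bd :: "nat \<Rightarrow> 'b \<Rightarrow> ('b \<Rightarrow>\<^sub>0 'r)"
  aug :: "'b \<Rightarrow> 'r"

definition free_module :: "'b set \<Rightarrow> ('b \<Rightarrow>\<^sub>0 'r::comm_ring_1) set" where
  "free_module B = {f. Poly_Mapping.keys f \<subseteq> B}"

definition lin_ext :: "('b \<Rightarrow> ('c \<Rightarrow>\<^sub>0 'r)) \<Rightarrow> ('b \<Rightarrow>\<^sub>0 'r::comm_ring_1) \<Rightarrow> ('c \<Rightarrow>\<^sub>0 'r)" where
  "lin_ext \<phi> f =
     (\<Sum>b\<in>Poly_Mapping.keys f. Poly_Mapping.map (\<lambda>r. Poly_Mapping.lookup f b * r) (\<phi> b))"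

definition residue_class :: "'r::comm_ring_1 set \<Rightarrow> 'r \<Rightarrow> 'r set" where
  "residue_class I r = {t. t - r \<in> I}"

definition aug_map ::
    "('b, 'r::comm_ring_1) based_complex \<Rightarrow> 'r set \<Rightarrow> ('b \<Rightarrow>\<^sub>0 'r) \<Rightarrow> 'r set" where
  "aug_map C I f =
     residue_class I (\<Sum>b\<in>Poly_Mapping.keys f. Poly_Mapping.lookup f b * aug C b)"

text \<open>
  The sequence \<open>\<dots> \<rightarrow> F\<^sub>2 \<rightarrow> F\<^sub>1 \<rightarrow> F\<^sub>0 \<rightarrow> R/I \<rightarrow> 0\<close> is exact, where \<open>F\<^sub>s\<close> is free on
  \<open>basis C s\<close> and \<open>R/I\<close> is the set of residue classes.
\<close>

definition free_resolution :: "('b, 'r::comm_ring_1) based_complex \<Rightarrow> 'r set \<Rightarrow> bool" where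
  "free_resolution C I \<longleftrightarrow>
     (\<forall>s. \<forall>b\<in>basis C (Suc s). bd C (Suc s) b \<in> free_module (basis C s)) \<and>
     (\<forall>s\<ge>1. {f \<in> free_module (basis C s). lin_ext (bd C s) f = 0} =
        lin_ext (bd C (Suc s)) ` free_module (basis C (Suc s))) \<and>
     {f \<in> free_module (basis C 0). aug_map C I f = residue_class I 0} =
        lin_ext (bd C 1) ` free_module (basis C 1) \<and>
     aug_map C I ` free_module (basis C 0) = residue_class I ` UNIV"

definition minimal_free_resolution :: "('b, 'r::comm_ring_1) based_complex \<Rightarrow> 'r set \<Rightarrow> bool" where
  "minimal_free_resolution C I \<longleftrightarrow>
     free_resolution C I \<and>
     (\<forall>s. \<forall>b\<in>basis C (Suc s). \<forall>c\<in>basis C s.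
        \<not> Poly_Mapping.lookup (bd C (Suc s) b) c dvd 1)"


subsection \<open>The Taylor resolution\<close>

text \<open>
  The Taylor symbol \<open>[m\<^sub>i\<^sub>1, \<dots>, m\<^sub>i\<^sub>s]\<close> is represented by the strictly increasing list of its
  indices. List positions start at \<open>0\<close>, hence the sign \<open>(-1)^j\<close> below.
\<close>

definition taylor_symbols :: "nat \<Rightarrow> nat \<Rightarrow> nat list set" where
  "taylor_symbols q s = {\<sigma>. sorted_wrt (<) \<sigma> \<and> set \<sigma> \<subseteq> {1..q} \<and> length \<sigma> = s}"

definition delete_nth :: "nat \<Rightarrow> 'a list \<Rightarrow> 'a list" where
  "delete_nth j xs = take j xs @ drop (Suc j) xs"

definition taylor_bd ::
    "(nat \<Rightarrow> 'x::finite mon) \<Rightarrow> nat list \<Rightarrow> (nat list \<Rightarrow>\<^sub>0 ('x, 'k::field) mpoly)" where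
  "taylor_bd m \<sigma> =
     (\<Sum>j<length \<sigma>. Poly_Mapping.single (delete_nth j \<sigma>)
        ((-1) ^ j * monom (mon_lcm (m ` set \<sigma>) - mon_lcm (m ` set (delete_nth j \<sigma>)))))"

definition taylor_resolution ::
    "nat \<Rightarrow> (nat \<Rightarrow> 'x::finite mon) \<Rightarrow> (nat list, ('x, 'k::field) mpoly) based_complex" where
  "taylor_resolution q m =
     \<lparr>basis = taylor_symbols q, bd = (\<lambda>_. taylor_bd m), aug = (\<lambda>_. 1)\<rparr>"


subsection \<open>Order of dominance\<close>

definition dominant_in :: "'x mon set \<Rightarrow> 'x mon \<Rightarrow> 'x \<Rightarrow> bool" where
  "dominant_in L a x \<longleftrightarrow>
     a \<in> L \<and> (\<forall>b\<in>L - {a}. Poly_Mapping.lookup b x < Poly_Mapping.lookup a x)"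

definition dominant_set :: "'x mon set \<Rightarrow> bool" where
  "dominant_set L \<longleftrightarrow> finite L \<and> (\<forall>a\<in>L. \<exists>x. dominant_in L a x)"

definition min_mon_gens :: "('x, 'k::field) mpoly set \<Rightarrow> 'x mon set" where
  "min_mon_gens M = (THE G. ideal_gen (monom ` G) = M \<and>
     (\<forall>H. H \<subset> G \<longrightarrow> ideal_gen (monom ` H) \<noteq> M))"

definition dominance_seqs :: "'x::{finite, linorder} mon set \<Rightarrow> 'x list set" where
  "dominance_seqs G = {vs. vs \<noteq> [] \<and> sorted_wrt (<) vs \<and>
     (\<exists>ds. distinct ds \<and> length ds = length vs \<and> set ds \<subseteq> G \<and> dominant_set (set ds) \<and>
        (\<forall>j<length vs. dominant_in (set ds) (ds ! j) (vs ! j)) \<and>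
        (\<forall>a\<in>G. mon_dvd a (mon_lcm (set ds)) \<longrightarrow>
           (\<exists>v\<in>set vs.
              mon_dvd (Poly_Mapping.single v (Poly_Mapping.lookup (mon_lcm (set ds)) v)) a)))}"

text \<open>\<open>odom M\<close> is the order of dominance of the quotient of the polynomial ring by \<open>M\<close>.\<close>

definition odom :: "('x::{finite, linorder}, 'k::field) mpoly set \<Rightarrow> nat" where
  "odom M = Max (length ` dominance_seqs (min_mon_gens M))"

end

theory Submission
  imports Defs
begin

text \<open>
  The Taylor complex is graded by monomials: the cell \<open>x\<^sup>a [\<sigma>]\<close> has multidegree \<open>a + lcm \<sigma>\<close>, and the
  part of multidegree \<open>u\<close> is the augmented chain complex of the full simplex on the indices \<open>i\<close>
  with \<open>m\<^sub>i\<close> dividing \<open>u\<close>. Coning off with the least such index is a contracting homotopy, so the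
  complex is always a resolution. Hence minimality only says that deleting an index from a symbol
  changes its lcm. It suffices to know this for the symbol on all of \<open>1, \<dots>, q\<close>, where it means
  that every \<open>m\<^sub>j\<close> strictly exceeds all the others in some variable, i.e. that the generators
  form a dominant set of \<open>q\<close> elements. Such a set is an antichain under divisibility, so it is
  the minimal generating set and realises order of dominance \<open>q\<close>; conversely a dominance sequence
  of length \<open>q\<close> must use all the generators.
\<close>

subsection \<open>Divisibility of monomials\<close>

lemma mon_dvd_iff: "mon_dvd a b \<longleftrightarrow> (\<forall>x. Poly_Mapping.lookup a x \<le> Poly_Mapping.lookup b x)"
proof
  show "mon_dvd a b \<Longrightarrow> \<forall>x. Poly_Mapping.lookup a x \<le> Poly_Mapping.lookup b x"
    by (auto simp: mon_dvd_def lookup_add)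
next
  assume "\<forall>x. Poly_Mapping.lookup a x \<le> Poly_Mapping.lookup b x"
  then have "b = a + (b - a)"
    by (intro poly_mapping_eqI) (simp add: lookup_add lookup_minus)
  then show "mon_dvd a b" unfolding mon_dvd_def ..
qed

lemma mon_dvd_refl: "mon_dvd a a"
  by (simp add: mon_dvd_iff)

lemma mon_dvd_trans: "mon_dvd a b \<Longrightarrow> mon_dvd b c \<Longrightarrow> mon_dvd a c"
  by (meson mon_dvd_iff le_trans)

lemma mon_dvd_antisym: "mon_dvd a b \<Longrightarrow> mon_dvd b a \<Longrightarrow> a = b"
  by (intro poly_mapping_eqI) (simp add: mon_dvd_iff antisym)

lemma mon_dvd_minus_add: "mon_dvd a b \<Longrightarrow> b - a + a = b"
  by (intro poly_mapping_eqI) (simp add: mon_dvd_iff lookup_add lookup_minus)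

lemma mon_dvd_minus_add_minus:
  "mon_dvd a b \<Longrightarrow> mon_dvd b c \<Longrightarrow> (c - b) + (b - a) = c - a"
  by (intro poly_mapping_eqI) (simp add: mon_dvd_iff lookup_add lookup_minus)

text \<open>Exponents subtract with truncation at 0, so the difference keeps only the excess of
  \<open>a\<close> over \<open>b\<close>. In a Taylor entry it detects whether deleting an index
  leaves the lcm unchanged.\<close>

lemma mon_minus_eq_0_iff: "a - b = 0 \<longleftrightarrow> mon_dvd a b" for a b :: "'x mon"
  by (simp add: mon_dvd_iff poly_mapping_eq_iff fun_eq_iff lookup_minus)

lemma mon_dvd_0_iff: "mon_dvd a 0 \<longleftrightarrow> a = 0"
  by (simp add: mon_dvd_iff poly_mapping_eq_iff fun_eq_iff)

lemma mon_lcm_dvd_iff: "finite A \<Longrightarrow> mon_dvd (mon_lcm A) u \<longleftrightarrow> (\<forall>a\<in>A. mon_dvd a u)"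
  by (auto simp: mon_dvd_iff lookup_mon_lcm)

lemma dvd_mon_lcm: "finite A \<Longrightarrow> a \<in> A \<Longrightarrow> mon_dvd a (mon_lcm A)"
  by (metis mon_lcm_dvd_iff mon_dvd_refl)

lemma mon_lcm_mono: "finite B \<Longrightarrow> A \<subseteq> B \<Longrightarrow> mon_dvd (mon_lcm A) (mon_lcm B)"
  by (meson dvd_mon_lcm finite_subset mon_lcm_dvd_iff subsetD)

subsection \<open>Monomial ideals\<close>

lemma module_mult: "module ((*) :: 'r::comm_ring_1 \<Rightarrow> 'r \<Rightarrow> 'r)"
  by unfold_locales (auto simp: algebra_simps)

lemma sum_single_lookup:
  "(\<Sum>u\<in>Poly_Mapping.keys p. Poly_Mapping.single u (Poly_Mapping.lookup p u)) = p"
proof (rule poly_mapping_eqI)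
  fix v
  have "Poly_Mapping.lookup
      (\<Sum>u\<in>Poly_Mapping.keys p. Poly_Mapping.single u (Poly_Mapping.lookup p u)) v =
      (\<Sum>u\<in>Poly_Mapping.keys p. if u = v then Poly_Mapping.lookup p u else 0)"
    by (simp add: lookup_sum lookup_single when_def)
  also have "\<dots> = Poly_Mapping.lookup p v"
    by (simp add: sum.delta in_keys_iff)
  finally show "Poly_Mapping.lookup
      (\<Sum>u\<in>Poly_Mapping.keys p. Poly_Mapping.single u (Poly_Mapping.lookup p u)) v =
      Poly_Mapping.lookup p v" .
qed

text \<open>The condition on the right is closed under sums and multiples and holds for the
  generators; conversely each term of \<open>p\<close> is a multiple of a generator. Ideal
  membership thereby becomes a question of divisibility.\<close>

lemma in_ideal_gen_monom_iff:
  fixes p :: "('x, 'k::field) mpoly"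
  shows "p \<in> ideal_gen (monom ` A) \<longleftrightarrow>
    (\<forall>u\<in>Poly_Mapping.keys p. \<exists>a\<in>A. mon_dvd a u)" (is "_ \<longleftrightarrow> ?P p")
proof
  interpret module "(*) :: ('x, 'k) mpoly \<Rightarrow> _ \<Rightarrow> _" by (rule module_mult)
  assume "p \<in> ideal_gen (monom ` A)"
  then have "p \<in> span (monom ` A)" by (simp add: ideal_gen_def)
  then show "?P p"
  proof (induction rule: span_induct_alt)
    case base
    then show ?case by simp
  next
    case (step r g p)
    obtain a where a: "a \<in> A" "g = monom a" using step by auto
    show ?case
    proof
      fix u assume "u \<in> Poly_Mapping.keys (r * g + p)"
      then have "u \<in> Poly_Mapping.keys (r * g) \<or> u \<in> Poly_Mapping.keys p"
        using keys_add[of "r * g" p] by (meson UnE subsetD)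
      then show "\<exists>a\<in>A. mon_dvd a u"
      proof
        assume "u \<in> Poly_Mapping.keys (r * g)"
        then have "u \<in> {b + c |b c. b \<in> Poly_Mapping.keys r \<and> c \<in> Poly_Mapping.keys g}"
          by (rule subsetD[OF keys_mult])
        then obtain b where "u = b + a" using a by (auto simp: monom_def)
        then have "mon_dvd a u" by (auto simp: mon_dvd_def add.commute)
        then show ?thesis using a by blast
      qed (use step in blast)
    qed
  qed
next
  interpret module "(*) :: ('x, 'k) mpoly \<Rightarrow> _ \<Rightarrow> _" by (rule module_mult)
  assume P: "?P p"
  have "Poly_Mapping.single u (Poly_Mapping.lookup p u) \<in> span (monom ` A)"
    if u: "u \<in> Poly_Mapping.keys p" for u
  proof -
    obtain a c where "a \<in> A" "u = a + c" using P u by (auto simp: mon_dvd_def)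
    then have "Poly_Mapping.single u (Poly_Mapping.lookup p u) =
        Poly_Mapping.single c (Poly_Mapping.lookup p u) * monom a"
      by (simp add: monom_def mult_single add.commute)
    then show ?thesis using \<open>a \<in> A\<close> by (simp add: span_base span_scale)
  qed
  then have "(\<Sum>u\<in>Poly_Mapping.keys p. Poly_Mapping.single u (Poly_Mapping.lookup p u))
      \<in> span (monom ` A)"
    by (rule span_sum)
  then show "p \<in> ideal_gen (monom ` A)"
    by (simp add: ideal_gen_def sum_single_lookup)
qed

lemma monom_in_ideal_gen_iff:
  "(monom a :: ('x, 'k::field) mpoly) \<in> ideal_gen (monom ` A) \<longleftrightarrow> (\<exists>b\<in>A. mon_dvd b a)"
  unfolding in_ideal_gen_monom_iff by (simp add: monom_def)

lemma ideal_gen_mult: "a \<in> ideal_gen B \<Longrightarrow> r * a \<in> ideal_gen B"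
  for a :: "'r::comm_ring_1"
  unfolding ideal_gen_def by (rule module.span_scale[OF module_mult])

section \<open>Minimal generating sets of monomial ideals\<close>

definition mon_minimals :: "'x mon set \<Rightarrow> 'x mon set" where
  "mon_minimals A = {a \<in> A. \<forall>b\<in>A. mon_dvd b a \<longrightarrow> b = a}"

text \<open>A proper divisor has smaller total degree, so a divisor of \<open>a\<close> in
  \<open>A\<close> of least degree is minimal. This also covers infinite \<open>A\<close>.\<close>

lemma exists_mon_minimal_dvd:
  fixes A :: "'x::finite mon set"
  assumes "a \<in> A"
  shows "\<exists>b\<in>mon_minimals A. mon_dvd b a"
proof -
  define deg where "deg b = (\<Sum>x\<in>UNIV. Poly_Mapping.lookup b x)" for b :: "'x mon"
  obtain b where b: "b \<in> A" "mon_dvd b a" "\<And>c. c \<in> A \<Longrightarrow> mon_dvd c a \<Longrightarrow> deg b \<le> deg c"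
    using ex_has_least_nat[of "\<lambda>c. c \<in> A \<and> mon_dvd c a" a deg] assms mon_dvd_refl by blast
  have "c = b" if c: "c \<in> A" "mon_dvd c b" for c
  proof (rule ccontr)
    assume "c \<noteq> b"
    then obtain x where "Poly_Mapping.lookup c x < Poly_Mapping.lookup b x"
      using c(2) by (metis mon_dvd_iff order_le_less poly_mapping_eqI)
    then have "deg c < deg b"
      unfolding deg_def using c(2) by (intro sum_strict_mono_ex1) (auto simp: mon_dvd_iff)
    then show False using b(3)[of c] c b(2) mon_dvd_trans by fastforce
  qed
  then show ?thesis using b by (auto simp: mon_minimals_def)
qed

text \<open>The definite description needs uniqueness. A minimal \<open>a\<close> is divisible by
  some \<open>g\<close> of any generating set \<open>G\<close>, and \<open>g\<close> by some
  \<open>b\<close> in \<open>A\<close>; minimality forces \<open>b = a\<close>, hence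
  \<open>g = a\<close>. So every generating set of monomials contains the minimal elements.\<close>

lemma min_mon_gens_ideal_gen:
  fixes A :: "'x::finite mon set"
  shows "min_mon_gens (ideal_gen (monom ` A) :: ('x, 'k::field) mpoly set) = mon_minimals A"
    (is "min_mon_gens ?M = ?B")
proof -
  have dvd: "(\<exists>b\<in>?B. mon_dvd b u) \<longleftrightarrow> (\<exists>a\<in>A. mon_dvd a u)" for u
  proof
    show "\<exists>b\<in>?B. mon_dvd b u \<Longrightarrow> \<exists>a\<in>A. mon_dvd a u"
      unfolding mon_minimals_def by blast
    show "\<exists>a\<in>A. mon_dvd a u \<Longrightarrow> \<exists>b\<in>?B. mon_dvd b u"
      by (meson exists_mon_minimal_dvd mon_dvd_trans)
  qed
  have gen: "ideal_gen (monom ` ?B) = ?M"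
  proof (intro set_eqI)
    fix p :: "('x, 'k) mpoly"
    show "p \<in> ideal_gen (monom ` ?B) \<longleftrightarrow> p \<in> ?M"
      unfolding in_ideal_gen_monom_iff using dvd by simp
  qed
  show ?thesis
    unfolding min_mon_gens_def
  proof (rule the_equality)
    have "ideal_gen (monom ` H) \<noteq> ?M" if H: "H \<subset> ?B" for H
    proof
      assume eq: "ideal_gen (monom ` H) = ?M"
      obtain a where a: "a \<in> ?B" "a \<notin> H" using H by blast
      have "(monom a :: ('x, 'k) mpoly) \<in> ?M"
        using a mon_dvd_refl by (auto simp: monom_in_ideal_gen_iff mon_minimals_def)
      then have "(monom a :: ('x, 'k) mpoly) \<in> ideal_gen (monom ` H)"
        by (simp only: eq)
      then obtain b where "b \<in> H" "mon_dvd b a"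
        unfolding monom_in_ideal_gen_iff by blast
      then show False using a H by (auto simp: mon_minimals_def)
    qed
    then show "ideal_gen (monom ` ?B) = ?M \<and> (\<forall>H. H \<subset> ?B \<longrightarrow> ideal_gen (monom ` H) \<noteq> ?M)"
      using gen by blast
  next
    fix G
    assume G: "ideal_gen (monom ` G) = ?M \<and> (\<forall>H. H \<subset> G \<longrightarrow> ideal_gen (monom ` H) \<noteq> ?M)"
    have "?B \<subseteq> G"
    proof
      fix a assume a: "a \<in> ?B"
      then have "(monom a :: ('x, 'k) mpoly) \<in> ideal_gen (monom ` G)"
        using G mon_dvd_refl by (auto simp: monom_in_ideal_gen_iff mon_minimals_def)
      then obtain g where g: "g \<in> G" "mon_dvd g a" by (auto simp: monom_in_ideal_gen_iff)
      have "(monom g :: ('x, 'k) mpoly) \<in> ideal_gen (monom ` G)"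
        using g mon_dvd_refl by (auto simp: monom_in_ideal_gen_iff)
      then have "(monom g :: ('x, 'k) mpoly) \<in> ?M" using G by simp
      then obtain b where "b \<in> A" "mon_dvd b g" by (auto simp: monom_in_ideal_gen_iff)
      then have "b = a" using a mon_dvd_trans[OF _ g(2)] by (simp add: mon_minimals_def)
      then have "g = a" using \<open>mon_dvd b g\<close> g(2) mon_dvd_antisym by simp
      then show "a \<in> G" using g by simp
    qed
    \<comment> \<open>\<open>?B\<close> already generates, so it cannot be a proper subset of the
      irredundant \<open>G\<close>.\<close>
    then show "G = ?B" using G gen by blast
  qed
qed

subsection \<open>Alternating sums over faces\<close>

text \<open>The simplicial boundary with the chain of each face given by \<open>E\<close>. The sign
  is a case distinction because the values lie in an arbitrary abelian group.\<close>

definition alt_faces :: "('a list \<Rightarrow> 'g::ab_group_add) \<Rightarrow> 'a list \<Rightarrow> 'g" where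
  "alt_faces E \<sigma> = (\<Sum>j<length \<sigma>. if even j then E (delete_nth j \<sigma>) else - E (delete_nth j \<sigma>))"

lemma alt_faces_Nil [simp]: "alt_faces E [] = 0"
  by (simp add: alt_faces_def)

text \<open>Position 0 deletes \<open>i\<close>; every later deletion is one in
  \<open>\<sigma>\<close> shifted by one position, hence with opposite sign. This is the formula for
  the boundary of a cone with apex \<open>i\<close>.\<close>

lemma alt_faces_Cons: "alt_faces E (i # \<sigma>) = E \<sigma> - alt_faces (\<lambda>\<rho>. E (i # \<rho>)) \<sigma>"
proof -
  have "alt_faces E (i # \<sigma>) = E \<sigma> +
      (\<Sum>j<length \<sigma>. - (if even j then E (i # delete_nth j \<sigma>) else - E (i # delete_nth j \<sigma>)))"
    unfolding alt_faces_def list.size(4) add_Suc_right add_0_right sum.lessThan_Suc_shift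
    by (intro arg_cong2[where f = "(+)"] sum.cong) (simp_all add: delete_nth_def)
  then show ?thesis by (simp add: alt_faces_def sum_negf)
qed

lemma alt_faces_diff: "alt_faces (\<lambda>\<rho>. E \<rho> - F \<rho>) \<sigma> = alt_faces E \<sigma> - alt_faces F \<sigma>"
  unfolding alt_faces_def sum_subtractf[symmetric] by (intro sum.cong) auto

text \<open>Expanding both boundaries at the head, the two copies of
  \<open>alt_faces E \<sigma>\<close> cancel. What remains is the double boundary over the tail for
  \<open>E\<close> with \<open>i\<close> prepended, so the induction must let \<open>E\<close>
  vary.\<close>

lemma alt_faces_alt_faces: "alt_faces (alt_faces E) \<sigma> = 0"
proof (induction \<sigma> arbitrary: E)
  case (Cons i \<sigma>)
  have "alt_faces (alt_faces E) (i # \<sigma>) = alt_faces (alt_faces (\<lambda>\<rho>. E (i # \<rho>))) \<sigma>"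
    by (simp add: alt_faces_Cons alt_faces_diff)
  then show ?case using Cons by simp
qed simp

lemma set_delete_nth_subset: "set (delete_nth j \<sigma>) \<subseteq> set \<sigma>"
  by (auto simp: delete_nth_def dest: in_set_takeD in_set_dropD)

lemma sorted_wrt_delete_nth:
  assumes "sorted_wrt R \<sigma>"
  shows "sorted_wrt R (delete_nth j \<sigma>)"
proof -
  have "sorted_wrt R (take j \<sigma> @ drop j \<sigma>)" using assms by simp
  then show ?thesis
    unfolding delete_nth_def sorted_wrt_append using assms
    by (meson le_SucI order_refl set_drop_subset_set_drop sorted_wrt_drop subsetD)
qed

lemma alt_faces_cong:
  assumes "\<And>\<rho>. set \<rho> \<subseteq> set \<sigma> \<Longrightarrow> E \<rho> = F \<rho>"
  shows "alt_faces E \<sigma> = alt_faces F \<sigma>"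
  using assms[OF set_delete_nth_subset] by (simp add: alt_faces_def cong: if_cong)

subsection \<open>Exactness of the Taylor complex\<close>

lemma lookup_map_mult:
  "Poly_Mapping.lookup (Poly_Mapping.map ((*) r) p) k = r * Poly_Mapping.lookup p k"
  for r :: "'r::comm_ring_1"
  by (simp add: Poly_Mapping.map.rep_eq when_def)

lemma additive_map_mult: "additive (Poly_Mapping.map ((*) (r :: 'r::comm_ring_1)))"
  by (rule additive.intro, rule poly_mapping_eqI)
    (simp add: lookup_map_mult lookup_add algebra_simps)

lemma map_mult_single:
  "Poly_Mapping.map ((*) (r :: 'r::comm_ring_1)) (Poly_Mapping.single b s) = Poly_Mapping.single b (r * s)"
  by (rule poly_mapping_eqI) (simp add: lookup_map_mult lookup_single when_def)

lemma map_mult_0: "Poly_Mapping.map ((*) (0 :: 'r::comm_ring_1)) p = 0"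
  by (rule poly_mapping_eqI) (simp only: lookup_map_mult lookup_zero mult_zero_left)

lemma map_mult_add:
  "Poly_Mapping.map ((*) (r + s :: 'r::comm_ring_1)) p =
    Poly_Mapping.map ((*) r) p + Poly_Mapping.map ((*) s) p"
  by (rule poly_mapping_eqI) (simp only: lookup_map_mult lookup_add distrib_right)

lemma additive_lin_ext: "additive (lin_ext \<phi>)"
proof
  fix f g
  show "lin_ext \<phi> (f + g) = lin_ext \<phi> f + lin_ext \<phi> g"
    unfolding lin_ext_def
    by (intro setsum_keys_plus_distrib map_mult_0 map_mult_add)
qed

lemma lin_ext_single:
  "lin_ext \<phi> (Poly_Mapping.single b r) = Poly_Mapping.map ((*) r) (\<phi> b)"
proof (cases "r = 0")
  case True
  then show ?thesis
    by (simp only: lin_ext_def single_zero keys_zero sum.empty map_mult_0)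
qed (simp add: lin_ext_def)

lemma additive_alt_faces:
  "additive F \<Longrightarrow> F (alt_faces E \<sigma>) = alt_faces (\<lambda>\<rho>. F (E \<rho>)) \<sigma>"
  unfolding alt_faces_def additive.sum by (intro sum.cong) (simp_all add: additive.minus)

text \<open>A module element is a finite sum of scalar multiples of a monomial times a basis
  element. Only additivity is asked for, since the homotopy below need not be linear over the
  polynomial ring.\<close>

lemma additive_eqI:
  fixes F :: "('b \<Rightarrow>\<^sub>0 ('a \<Rightarrow>\<^sub>0 'k::ab_group_add)) \<Rightarrow> 'g::ab_group_add"
  assumes "additive F" "additive F'"
    and "\<And>b a c. b \<in> Poly_Mapping.keys f \<Longrightarrow> a \<in> Poly_Mapping.keys (Poly_Mapping.lookup f b) \<Longrightarrow>
      F (Poly_Mapping.single b (Poly_Mapping.single a c)) =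
      F' (Poly_Mapping.single b (Poly_Mapping.single a c))"
  shows "F f = F' f"
proof -
  have single_add: "additive (Poly_Mapping.single b :: _ \<Rightarrow> 'b \<Rightarrow>\<^sub>0 ('a \<Rightarrow>\<^sub>0 'k))" for b
    by (rule additive.intro) (rule single_add)
  have f: "f = (\<Sum>b\<in>Poly_Mapping.keys f. \<Sum>a\<in>Poly_Mapping.keys (Poly_Mapping.lookup f b).
      Poly_Mapping.single b (Poly_Mapping.single a (Poly_Mapping.lookup (Poly_Mapping.lookup f b) a)))"
    (is "_ = ?R")
    unfolding additive.sum[OF single_add, symmetric] sum_single_lookup ..
  have "F ?R = F' ?R"
    unfolding additive.sum[OF assms(1)] additive.sum[OF assms(2)]
    using assms(3) by (intro sum.cong) auto
  then show ?thesis using f by simp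
qed

text \<open>The multiple \<open>c\<close> of the cell on \<open>\<sigma>\<close> of multidegree \<open>u\<close>; meaningful only if \<open>lcm \<sigma>\<close> divides \<open>u\<close>,
  since the subtraction of exponents is truncated.\<close>

definition taylor_cell :: "(nat \<Rightarrow> 'x::finite mon) \<Rightarrow> 'k::field \<Rightarrow> 'x mon \<Rightarrow> nat list \<Rightarrow>
    (nat list \<Rightarrow>\<^sub>0 ('x, 'k) mpoly)" where
  "taylor_cell m c u \<sigma> =
     Poly_Mapping.single \<sigma> (Poly_Mapping.single (u - mon_lcm (m ` set \<sigma>)) c)"

lemma single_single_eq_taylor_cell:
  "Poly_Mapping.single \<sigma> (Poly_Mapping.single a c) =
    taylor_cell m c (a + mon_lcm (m ` set \<sigma>)) \<sigma>"
  by (simp add: taylor_cell_def)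

lemma mon_lcm_symbol_dvd_subset:
  "mon_dvd (mon_lcm (m ` set \<sigma>)) u \<Longrightarrow> set \<rho> \<subseteq> set \<sigma> \<Longrightarrow> mon_dvd (mon_lcm (m ` set \<rho>)) u"
  by (auto simp: mon_lcm_dvd_iff)

text \<open>The exponents telescope: \<open>u - lcm \<sigma>\<close> plus
  \<open>lcm \<sigma> - lcm \<rho>\<close> is \<open>u - lcm \<rho>\<close> for a face
  \<open>\<rho>\<close>. All faces thus keep the multidegree \<open>u\<close>, and the Taylor
  differential turns into the simplicial boundary.\<close>

lemma lin_ext_taylor_bd_cell:
  assumes "mon_dvd (mon_lcm (m ` set \<sigma>)) u"
  shows "lin_ext (taylor_bd m) (taylor_cell m c u \<sigma>) = alt_faces (taylor_cell m c u) \<sigma>"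
  unfolding taylor_cell_def[of m c u \<sigma>] lin_ext_single taylor_bd_def alt_faces_def
    additive.sum[OF additive_map_mult] map_mult_single
proof (rule sum.cong[OF refl])
  fix j
  have dvd: "mon_dvd (mon_lcm (m ` set (delete_nth j \<sigma>))) (mon_lcm (m ` set \<sigma>))"
    by (intro mon_lcm_mono image_mono set_delete_nth_subset) simp
  have "Poly_Mapping.single (u - mon_lcm (m ` set \<sigma>)) c *
      monom (mon_lcm (m ` set \<sigma>) - mon_lcm (m ` set (delete_nth j \<sigma>))) =
      Poly_Mapping.single (u - mon_lcm (m ` set (delete_nth j \<sigma>))) c"
    by (simp add: monom_def mult_single mon_dvd_minus_add_minus[OF dvd assms])
  then show "Poly_Mapping.single (delete_nth j \<sigma>) (Poly_Mapping.single (u - mon_lcm (m ` set \<sigma>)) c *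
      ((- 1) ^ j * monom (mon_lcm (m ` set \<sigma>) - mon_lcm (m ` set (delete_nth j \<sigma>))))) =
      (if even j then taylor_cell m c u (delete_nth j \<sigma>) else - taylor_cell m c u (delete_nth j \<sigma>))"
    by (simp add: taylor_cell_def single_uminus)
qed

lemma lin_ext_taylor_bd_twice:
  fixes f :: "nat list \<Rightarrow>\<^sub>0 ('x::finite, 'k::field) mpoly"
  shows "lin_ext (taylor_bd m) (lin_ext (taylor_bd m) f) = 0"
proof -
  let ?dd = "\<lambda>f :: nat list \<Rightarrow>\<^sub>0 ('x, 'k) mpoly. lin_ext (taylor_bd m) (lin_ext (taylor_bd m) f)"
  have "?dd f = (\<lambda>f. 0) f"
  proof (rule additive_eqI[where F = ?dd and F' = "\<lambda>f. 0"])
    show "additive ?dd"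
      by (rule additive.intro) (simp add: additive.add[OF additive_lin_ext])
    show "additive (\<lambda>f :: nat list \<Rightarrow>\<^sub>0 ('x, 'k) mpoly. 0 :: nat list \<Rightarrow>\<^sub>0 ('x, 'k) mpoly)"
      by (rule additive.intro) simp
    fix \<sigma> :: "nat list" and a
    define u where "u = a + mon_lcm (m ` set \<sigma>)"
    have u: "mon_dvd (mon_lcm (m ` set \<sigma>)) u"
      by (auto simp: u_def mon_dvd_def add.commute)
    fix c :: 'k
    have "lin_ext (taylor_bd m) (lin_ext (taylor_bd m) (taylor_cell m c u \<sigma>)) =
        alt_faces (\<lambda>\<rho>. lin_ext (taylor_bd m) (taylor_cell m c u \<rho>)) \<sigma>"
      by (simp add: lin_ext_taylor_bd_cell[OF u] additive_alt_faces[OF additive_lin_ext])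
    also have "\<dots> = alt_faces (alt_faces (taylor_cell m c u)) \<sigma>"
      by (rule alt_faces_cong) (rule lin_ext_taylor_bd_cell[OF mon_lcm_symbol_dvd_subset[OF u]])
    finally show "?dd (Poly_Mapping.single \<sigma> (Poly_Mapping.single a c)) = 0"
      by (simp add: single_single_eq_taylor_cell[where m = m] u_def alt_faces_alt_faces)
  qed
  then show ?thesis by simp
qed

section \<open>The contracting homotopy\<close>

definition least_divisor :: "nat \<Rightarrow> (nat \<Rightarrow> 'x mon) \<Rightarrow> 'x mon \<Rightarrow> nat" where
  "least_divisor q m u = (LEAST i. i \<in> {1..q} \<and> mon_dvd (m i) u)"

text \<open>The indices of a cell of multidegree \<open>u\<close> are all at least \<open>least_divisor q m u\<close>, so prepending it
  keeps the list increasing.\<close>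

definition cone_cell :: "nat \<Rightarrow> (nat \<Rightarrow> 'x::finite mon) \<Rightarrow> 'k::field \<Rightarrow> 'x mon \<Rightarrow> nat list \<Rightarrow>
    (nat list \<Rightarrow>\<^sub>0 ('x, 'k) mpoly)" where
  "cone_cell q m c u \<sigma> =
     (if (\<exists>i\<in>{1..q}. mon_dvd (m i) u) \<and> least_divisor q m u \<notin> set \<sigma>
      then taylor_cell m c u (least_divisor q m u # \<sigma>) else 0)"

text \<open>Coning is extended term by term instead of by \<open>lin_ext\<close>, because the apex
  changes with the multidegree of the term.\<close>

definition taylor_homotopy :: "nat \<Rightarrow> (nat \<Rightarrow> 'x::finite mon) \<Rightarrow>
    (nat list \<Rightarrow>\<^sub>0 ('x, 'k::field) mpoly) \<Rightarrow> (nat list \<Rightarrow>\<^sub>0 ('x, 'k) mpoly)" where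
  "taylor_homotopy q m f =
     (\<Sum>\<sigma>\<in>Poly_Mapping.keys f. \<Sum>a\<in>Poly_Mapping.keys (Poly_Mapping.lookup f \<sigma>).
        cone_cell q m (Poly_Mapping.lookup (Poly_Mapping.lookup f \<sigma>) a)
          (a + mon_lcm (m ` set \<sigma>)) \<sigma>)"

lemma least_divisor:
  assumes "i \<in> {1..q}" "mon_dvd (m i) u"
  shows "least_divisor q m u \<in> {1..q}" "mon_dvd (m (least_divisor q m u)) u"
    "least_divisor q m u \<le> i"
proof -
  show "least_divisor q m u \<in> {1..q}" "mon_dvd (m (least_divisor q m u)) u"
    using LeastI[of "\<lambda>i. i \<in> {1..q} \<and> mon_dvd (m i) u" i] assms by (auto simp: least_divisor_def)
  show "least_divisor q m u \<le> i"
    unfolding least_divisor_def using assms by (intro Least_le) simp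
qed

lemma cone_cell_0: "cone_cell q m 0 u \<sigma> = 0"
  by (simp add: cone_cell_def taylor_cell_def)

lemma cone_cell_add: "cone_cell q m (c + d) u \<sigma> = cone_cell q m c u \<sigma> + cone_cell q m d u \<sigma>"
  by (simp add: cone_cell_def taylor_cell_def single_add)

lemma additive_taylor_homotopy: "additive (taylor_homotopy q m)"
proof
  fix f g :: "nat list \<Rightarrow>\<^sub>0 ('a, 'b) mpoly"
  define h where "h \<sigma> p = (\<Sum>a\<in>Poly_Mapping.keys p.
    cone_cell q m (Poly_Mapping.lookup p a) (a + mon_lcm (m ` set \<sigma>)) \<sigma>)"
    for \<sigma> and p :: "('a, 'b) mpoly"
  have h_add: "h \<sigma> (p + r) = h \<sigma> p + h \<sigma> r" for \<sigma> p r
    unfolding h_def by (rule setsum_keys_plus_distrib) (simp_all add: cone_cell_0 cone_cell_add)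
  have "h \<sigma> 0 = 0" for \<sigma> by (simp add: h_def)
  then show "taylor_homotopy q m (f + g) = taylor_homotopy q m f + taylor_homotopy q m g"
    unfolding taylor_homotopy_def h_def[symmetric]
    by (intro setsum_keys_plus_distrib) (simp_all add: h_add)
qed

lemma taylor_homotopy_cell:
  assumes "mon_dvd (mon_lcm (m ` set \<sigma>)) u"
  shows "taylor_homotopy q m (taylor_cell m c u \<sigma>) = cone_cell q m c u \<sigma>"
proof (cases "c = 0")
  case False
  then have "Poly_Mapping.single (u - mon_lcm (m ` set \<sigma>)) c \<noteq> 0"
    by (metis lookup_single_eq lookup_zero)
  with False show ?thesis
    by (simp add: taylor_homotopy_def taylor_cell_def mon_dvd_minus_add[OF assms])
qed (simp add: taylor_homotopy_def taylor_cell_def cone_cell_0)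

text \<open>If the apex is missing from \<open>\<sigma>\<close>, this is the boundary formula for a
  cone. If it occurs, it is the head of \<open>\<sigma>\<close>: then \<open>\<sigma>\<close> and
  all its faces through the apex are coned to 0, and the one remaining face is coned back to
  \<open>\<sigma>\<close>. The index \<open>i\<close> guarantees that an apex exists.\<close>

lemma taylor_homotopy_identity_cell:
  assumes \<sigma>: "sorted_wrt (<) \<sigma>" "set \<sigma> \<subseteq> {1..q}" "mon_dvd (mon_lcm (m ` set \<sigma>)) u"
    and i: "i \<in> {1..q}" "mon_dvd (m i) u"
  shows "lin_ext (taylor_bd m) (taylor_homotopy q m (taylor_cell m c u \<sigma>)) +
    taylor_homotopy q m (lin_ext (taylor_bd m) (taylor_cell m c u \<sigma>)) = taylor_cell m c u \<sigma>"
proof -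
  \<comment> \<open>The apex depends on \<open>u\<close> alone, so the cell and all its faces share
    it.\<close>
  let ?i = "least_divisor q m u"
  have "taylor_homotopy q m (lin_ext (taylor_bd m) (taylor_cell m c u \<sigma>)) =
      alt_faces (\<lambda>\<rho>. taylor_homotopy q m (taylor_cell m c u \<rho>)) \<sigma>"
    by (simp add: lin_ext_taylor_bd_cell[OF \<sigma>(3)] additive_alt_faces[OF additive_taylor_homotopy])
  also have "\<dots> = alt_faces (cone_cell q m c u) \<sigma>"
    by (rule alt_faces_cong) (rule taylor_homotopy_cell[OF mon_lcm_symbol_dvd_subset[OF \<sigma>(3)]])
  finally have hd: "taylor_homotopy q m (lin_ext (taylor_bd m) (taylor_cell m c u \<sigma>)) =
      alt_faces (cone_cell q m c u) \<sigma>" .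
  have cone: "cone_cell q m c u \<rho> = taylor_cell m c u (?i # \<rho>)" if "?i \<notin> set \<rho>" for \<rho>
    using that i by (auto simp: cone_cell_def)
  show ?thesis
  proof (cases "?i \<in> set \<sigma>")
    case True
    then obtain k \<tau> where k: "\<sigma> = k # \<tau>" by (cases \<sigma>) auto
    have "k \<in> {1..q}" "mon_dvd (m k) u"
      using \<sigma> k by (auto simp: mon_lcm_dvd_iff)
    then have "?i \<le> k" by (rule least_divisor)
    then have \<tau>: "\<sigma> = ?i # \<tau>" "?i \<notin> set \<tau>"
      using True \<sigma>(1) k by auto
    \<comment> \<open>These are the faces that still contain the apex.\<close>
    have "alt_faces (\<lambda>\<rho>. cone_cell q m c u (?i # \<rho>)) \<tau> = 0"
      by (simp add: cone_cell_def alt_faces_def cong: if_cong)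
    then have "alt_faces (cone_cell q m c u) \<sigma> = taylor_cell m c u \<sigma>"
      using \<tau>(2) by (subst (1 2) \<tau>(1)) (simp add: alt_faces_Cons cone)
    moreover have "taylor_homotopy q m (taylor_cell m c u \<sigma>) = 0"
      using True by (simp add: taylor_homotopy_cell[OF \<sigma>(3)] cone_cell_def)
    ultimately show ?thesis
      by (simp add: hd additive.zero[OF additive_lin_ext])
  next
    case False
    have dvd: "mon_dvd (mon_lcm (m ` set (?i # \<sigma>))) u"
      using \<sigma>(3) least_divisor(2)[where m = m, OF i] by (simp add: mon_lcm_dvd_iff)
    have "lin_ext (taylor_bd m) (taylor_homotopy q m (taylor_cell m c u \<sigma>)) =
        taylor_cell m c u \<sigma> - alt_faces (\<lambda>\<rho>. taylor_cell m c u (?i # \<rho>)) \<sigma>"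
      by (simp add: taylor_homotopy_cell[OF \<sigma>(3)] cone[OF False] lin_ext_taylor_bd_cell[OF dvd]
          alt_faces_Cons)
    moreover have "alt_faces (\<lambda>\<rho>. taylor_cell m c u (?i # \<rho>)) \<sigma> = alt_faces (cone_cell q m c u) \<sigma>"
      using False cone by (intro alt_faces_cong) (metis subsetD)
    ultimately show ?thesis by (simp add: hd)
  qed
qed

text \<open>A nonempty symbol supplies a generator dividing its multidegree, namely that of any of
  its indices. For the empty symbol the multidegree is that of the coefficient term, and membership
  in the ideal has to supply the generator.\<close>

lemma taylor_homotopy_identity:
  fixes f :: "nat list \<Rightarrow>\<^sub>0 ('x::finite, 'k::field) mpoly"
  assumes f: "f \<in> free_module (taylor_symbols q s)"
    and "s = 0 \<Longrightarrow> Poly_Mapping.lookup f [] \<in> ideal_gen (monom ` m ` {1..q})"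
  shows "lin_ext (taylor_bd m) (taylor_homotopy q m f) +
    taylor_homotopy q m (lin_ext (taylor_bd m) f) = f"
proof -
  let ?H = "\<lambda>f :: nat list \<Rightarrow>\<^sub>0 ('x, 'k) mpoly. lin_ext (taylor_bd m) (taylor_homotopy q m f) +
    taylor_homotopy q m (lin_ext (taylor_bd m) f)"
  have "?H f = (\<lambda>f. f) f"
  proof (rule additive_eqI[where F = ?H and F' = "\<lambda>f. f"])
    show "additive ?H"
      by (rule additive.intro)
        (simp add: additive.add[OF additive_lin_ext] additive.add[OF additive_taylor_homotopy])
    show "additive (\<lambda>f :: nat list \<Rightarrow>\<^sub>0 ('x, 'k) mpoly. f)" by (rule additive.intro) simp
    fix \<sigma> a
    assume \<sigma>: "\<sigma> \<in> Poly_Mapping.keys f" and a: "a \<in> Poly_Mapping.keys (Poly_Mapping.lookup f \<sigma>)"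
    define u where "u = a + mon_lcm (m ` set \<sigma>)"
    have u: "mon_dvd (mon_lcm (m ` set \<sigma>)) u"
      by (auto simp: u_def mon_dvd_def add.commute)
    have sym: "sorted_wrt (<) \<sigma>" "set \<sigma> \<subseteq> {1..q}" "length \<sigma> = s"
      using f \<sigma> by (auto simp: free_module_def taylor_symbols_def)
    have "\<exists>i\<in>{1..q}. mon_dvd (m i) u"
    proof (cases \<sigma>)
      case Nil
      then have "Poly_Mapping.lookup f [] \<in> ideal_gen (monom ` m ` {1..q})"
        using assms(2) sym(3) by simp
      then obtain i where "i \<in> {1..q}" "mon_dvd (m i) a"
        using a Nil by (auto simp: in_ideal_gen_monom_iff)
      moreover have "mon_dvd a u" by (auto simp: u_def mon_dvd_def)
      ultimately show ?thesis using mon_dvd_trans by blast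
    next
      case (Cons i \<tau>)
      then show ?thesis using u sym(2) by (auto simp: mon_lcm_dvd_iff)
    qed
    then obtain i where i: "i \<in> {1..q}" "mon_dvd (m i) u" by blast
    fix c
    show "?H (Poly_Mapping.single \<sigma> (Poly_Mapping.single a c)) =
        Poly_Mapping.single \<sigma> (Poly_Mapping.single a c)"
      using taylor_homotopy_identity_cell[OF sym(1,2) u i]
      by (simp add: single_single_eq_taylor_cell[where m = m] u_def)
  qed
  then show ?thesis .
qed

section \<open>Homological degrees of differential and homotopy\<close>

lemma delete_nth_in_taylor_symbols:
  assumes "\<sigma> \<in> taylor_symbols q (Suc s)" "j < Suc s"
  shows "delete_nth j \<sigma> \<in> taylor_symbols q s"
  using assms set_delete_nth_subset[of j \<sigma>] sorted_wrt_delete_nth[of "(<)" \<sigma> j]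
  by (auto simp: taylor_symbols_def delete_nth_def)

lemma free_module_0: "0 \<in> free_module B"
  by (simp add: free_module_def)

lemma free_module_single: "b \<in> B \<Longrightarrow> Poly_Mapping.single b r \<in> free_module B"
  by (simp add: free_module_def)

lemma free_module_sum: "(\<And>i. i \<in> I \<Longrightarrow> f i \<in> free_module B) \<Longrightarrow> sum f I \<in> free_module B"
  using keys_sum[of f I] by (fastforce simp: free_module_def)

lemma taylor_bd_in_free_module:
  "\<sigma> \<in> taylor_symbols q (Suc s) \<Longrightarrow> taylor_bd m \<sigma> \<in> free_module (taylor_symbols q s)"
  unfolding taylor_bd_def
  by (intro free_module_sum free_module_single delete_nth_in_taylor_symbols)
    (auto simp: taylor_symbols_def)

lemma lin_ext_in_free_module:
  assumes "\<And>b. b \<in> B \<Longrightarrow> \<phi> b \<in> free_module C" "f \<in> free_module B"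
  shows "lin_ext \<phi> f \<in> free_module C"
  unfolding lin_ext_def
proof (rule free_module_sum)
  fix b assume "b \<in> Poly_Mapping.keys f"
  then have "\<phi> b \<in> free_module C" using assms by (auto simp: free_module_def)
  then show "Poly_Mapping.map ((*) (Poly_Mapping.lookup f b)) (\<phi> b) \<in> free_module C"
    by (fastforce simp: free_module_def in_keys_iff lookup_map_mult)
qed

lemma taylor_homotopy_in_free_module:
  assumes "f \<in> free_module (taylor_symbols q s)"
  shows "taylor_homotopy q m f \<in> free_module (taylor_symbols q (Suc s))"
  unfolding taylor_homotopy_def
proof (intro free_module_sum)
  fix \<sigma> a c
  assume "\<sigma> \<in> Poly_Mapping.keys f"
  then have \<sigma>: "\<sigma> \<in> taylor_symbols q s" using assms by (auto simp: free_module_def)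
  define u where "u = a + mon_lcm (m ` set \<sigma>)"
  have u: "mon_dvd (mon_lcm (m ` set \<sigma>)) u"
    by (auto simp: u_def mon_dvd_def add.commute)
  have "least_divisor q m u # \<sigma> \<in> taylor_symbols q (Suc s)"
    if "i \<in> {1..q}" "mon_dvd (m i) u" "least_divisor q m u \<notin> set \<sigma>" for i
  proof -
    have "least_divisor q m u < j" if j: "j \<in> set \<sigma>" for j
    proof -
      have "j \<in> {1..q}" "mon_dvd (m j) u"
        using \<sigma> u j by (auto simp: taylor_symbols_def mon_lcm_dvd_iff)
      then have "least_divisor q m u \<le> j" by (rule least_divisor)
      then show ?thesis using j \<open>least_divisor q m u \<notin> set \<sigma>\<close> by (metis le_neq_implies_less)
    qed
    moreover have "least_divisor q m u \<in> {1..q}" using that(1,2) by (rule least_divisor)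
    ultimately show ?thesis using \<sigma> by (simp add: taylor_symbols_def)
  qed
  then show "cone_cell q m c u \<sigma> \<in> free_module (taylor_symbols q (Suc s))"
    by (auto simp: cone_cell_def taylor_cell_def free_module_0 intro!: free_module_single)
qed

lemma residue_class_eq_0_iff:
  fixes r :: "'r::comm_ring_1"
  shows "residue_class (ideal_gen B) r = residue_class (ideal_gen B) 0 \<longleftrightarrow> r \<in> ideal_gen B"
proof -
  interpret module "(*) :: 'r \<Rightarrow> _ \<Rightarrow> _" by (rule module_mult)
  show ?thesis
    unfolding residue_class_def ideal_gen_def set_eq_iff mem_Collect_eq
    by (metis diff_0_right diff_self span_diff span_zero span_add diff_add_cancel)
qed

lemma taylor_symbols_0: "taylor_symbols q 0 = {[]}"
  by (auto simp: taylor_symbols_def)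

theorem taylor_free_resolution:
  fixes m :: "nat \<Rightarrow> 'x::finite mon"
  shows "free_resolution (taylor_resolution q m) (ideal_gen (monom ` m ` {1..q}) :: ('x, 'k::field) mpoly set)"
    (is "free_resolution ?T ?I")
proof -
  interpret ideal: module "(*) :: ('x, 'k) mpoly \<Rightarrow> _ \<Rightarrow> _" by (rule module_mult)
  define F :: "nat \<Rightarrow> (nat list \<Rightarrow>\<^sub>0 ('x, 'k) mpoly) set"
    where "F s = free_module (taylor_symbols q s)" for s
  define d :: "(nat list \<Rightarrow>\<^sub>0 ('x, 'k) mpoly) \<Rightarrow> (nat list \<Rightarrow>\<^sub>0 ('x, 'k) mpoly)"
    where "d = lin_ext (taylor_bd m)"
  have d_in: "d f \<in> F s" if "f \<in> F (Suc s)" for f s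
    using that unfolding F_def d_def
    by (intro lin_ext_in_free_module[OF taylor_bd_in_free_module])
  have in_image: "f \<in> d ` F (Suc s)"
    if "f \<in> F s" "d f = 0" "s = 0 \<Longrightarrow> Poly_Mapping.lookup f [] \<in> ?I" for f s
  proof
    show "taylor_homotopy q m f \<in> F (Suc s)"
      using that taylor_homotopy_in_free_module by (simp add: F_def)
    show "f = d (taylor_homotopy q m f)"
      using taylor_homotopy_identity[of f q s m] that
      by (simp add: F_def d_def additive.zero[OF additive_taylor_homotopy])
  qed
  have aug: "aug_map ?T ?I f = residue_class ?I (Poly_Mapping.lookup f [])" if "f \<in> F 0" for f
  proof -
    have "Poly_Mapping.keys f \<subseteq> {[]}"
      using that by (simp add: F_def free_module_def taylor_symbols_0)
    then have "(\<Sum>b\<in>Poly_Mapping.keys f. Poly_Mapping.lookup f b) =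
        (\<Sum>b\<in>{[]}. Poly_Mapping.lookup f b)"
      by (intro sum.mono_neutral_left) (auto simp: in_keys_iff)
    then show ?thesis by (simp add: aug_map_def taylor_resolution_def)
  qed
  \<comment> \<open>The differential formula gives an empty sum on the empty symbol. Hence
    \<open>in_image\<close> also applies in degree 0, to elements whose coefficient lies in the
    ideal.\<close>
  have d0: "d f = 0" if "f \<in> F 0" for f
  proof -
    have "lin_ext (taylor_bd m) f = (\<Sum>b\<in>Poly_Mapping.keys f. 0)"
      unfolding lin_ext_def
    proof (rule sum.cong[OF refl])
      fix \<sigma> assume "\<sigma> \<in> Poly_Mapping.keys f"
      then have "\<sigma> = []" using that by (auto simp: F_def free_module_def taylor_symbols_0)
      then show "Poly_Mapping.map ((*) (Poly_Mapping.lookup f \<sigma>)) (taylor_bd m \<sigma>) = 0"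
        by (simp add: taylor_bd_def additive.zero[OF additive_map_mult])
    qed
    then show ?thesis by (simp add: d_def)
  qed
  have image_ideal: "Poly_Mapping.lookup (d f) [] \<in> ?I" if "f \<in> F 1" for f
    unfolding d_def lin_ext_def lookup_sum ideal_gen_def
  proof (rule ideal.span_sum)
    fix \<sigma> assume "\<sigma> \<in> Poly_Mapping.keys f"
    then have "\<sigma> \<in> taylor_symbols q 1"
      using that by (auto simp: F_def free_module_def)
    then obtain i where i: "\<sigma> = [i]" "i \<in> {1..q}"
      by (auto simp: taylor_symbols_def length_Suc_conv)
    \<comment> \<open>The lcm of the empty symbol is the monomial 1, so the only entry in the column
      of \<open>[i]\<close> is the generator itself.\<close>
    have "mon_lcm (m ` set \<sigma>) = m i" "mon_lcm (m ` {}) = 0"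
      by (simp_all add: poly_mapping_eq_iff fun_eq_iff lookup_mon_lcm i)
    then have "Poly_Mapping.lookup (taylor_bd m \<sigma>) [] = (monom (m i) :: ('x, 'k) mpoly)"
      using i by (simp add: taylor_bd_def delete_nth_def)
    then show "Poly_Mapping.lookup (Poly_Mapping.map ((*) (Poly_Mapping.lookup f \<sigma>)) (taylor_bd m \<sigma>)) []
        \<in> ideal.span (monom ` m ` {1..q})"
      using i by (simp only: lookup_map_mult) (intro ideal.span_scale ideal.span_base, simp)
  qed
  have "{f \<in> F s. d f = 0} = d ` F (Suc s)" if "s \<ge> 1" for s
    using that in_image d_in lin_ext_taylor_bd_twice by (auto simp: d_def)
  moreover have "{f \<in> F 0. aug_map ?T ?I f = residue_class ?I 0} = d ` F 1"
  proof -
    have "{f \<in> F 0. aug_map ?T ?I f = residue_class ?I 0} = {f \<in> F 0. Poly_Mapping.lookup f [] \<in> ?I}"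
      using aug residue_class_eq_0_iff by (metis (no_types, lifting))
    also have "\<dots> = d ` F 1"
      using in_image[of _ 0] d0 d_in[of _ 0] image_ideal by auto
    finally show ?thesis .
  qed
  moreover have "aug_map ?T ?I ` F 0 = residue_class ?I ` UNIV"
  proof -
    have "residue_class ?I r \<in> aug_map ?T ?I ` F 0" for r
    proof
      show "Poly_Mapping.single [] r \<in> F 0"
        by (simp add: F_def taylor_symbols_0 free_module_single)
      then show "residue_class ?I r = aug_map ?T ?I (Poly_Mapping.single [] r)"
        by (simp only: aug lookup_single_eq)
    qed
    then show ?thesis using aug by auto
  qed
  ultimately show ?thesis
    unfolding free_resolution_def F_def d_def
    by (auto simp: taylor_resolution_def intro: taylor_bd_in_free_module)
qed

subsection \<open>Minimality\<close>

text \<open>The ideal consists of the polynomials without constant term. A unit in it would put 1 in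
  it as well, but no monomial other than 1 divides 1.\<close>

lemma not_dvd_1_if_nonconstant:
  fixes p :: "('x, 'k::field) mpoly"
  assumes "p \<in> ideal_gen (monom ` (- {0}))"
  shows "\<not> p dvd 1"
proof
  assume "p dvd 1"
  then obtain r where "1 = r * p" by (metis dvdE mult.commute)
  then have "(monom 0 :: ('x, 'k) mpoly) \<in> ideal_gen (monom ` (- {0}))"
    using ideal_gen_mult[OF assms, of r] by (simp only: monom_def single_one)
  then show False by (auto simp only: monom_in_ideal_gen_iff mon_dvd_0_iff)
qed

lemma set_delete_nth:
  assumes "distinct xs" "j < length xs"
  shows "set (delete_nth j xs) = set xs - {xs ! j}"
proof -
  have "xs = take j xs @ xs ! j # drop (Suc j) xs" using assms(2) by (rule id_take_nth_drop)
  then have "distinct (take j xs @ xs ! j # drop (Suc j) xs)"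
    and "set xs = set (take j xs @ xs ! j # drop (Suc j) xs)"
    using assms(1) by simp_all
  then show ?thesis by (auto simp: delete_nth_def)
qed

text \<open>Positivity matters only when \<open>J\<close> is a singleton: it excludes the generator \<open>1\<close>.\<close>

definition strictly_dominant :: "nat set \<Rightarrow> (nat \<Rightarrow> 'x mon) \<Rightarrow> bool" where
  "strictly_dominant J m \<longleftrightarrow> (\<forall>j\<in>J. \<exists>x. 0 < Poly_Mapping.lookup (m j) x \<and>
     (\<forall>i\<in>J - {j}. Poly_Mapping.lookup (m i) x < Poly_Mapping.lookup (m j) x))"

text \<open>The lcm grows with \<open>j\<close> iff \<open>m j\<close> does not divide the lcm of
  the others, i.e. iff some exponent of \<open>m j\<close> exceeds their maximum. The 0 inserted
  into that maximum yields the positivity condition.\<close>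

lemma strictly_dominant_iff_lcm:
  assumes "finite J"
  shows "strictly_dominant J m \<longleftrightarrow>
    (\<forall>j\<in>J. \<not> mon_dvd (mon_lcm (m ` J)) (mon_lcm (m ` (J - {j}))))"
  unfolding strictly_dominant_def
proof (rule ball_cong[OF refl])
  fix j assume j: "j \<in> J"
  have "mon_dvd (mon_lcm (m ` J)) (mon_lcm (m ` (J - {j}))) \<longleftrightarrow>
      (\<forall>i\<in>J. mon_dvd (m i) (mon_lcm (m ` (J - {j}))))"
    using assms by (simp add: mon_lcm_dvd_iff)
  also have "\<dots> \<longleftrightarrow> mon_dvd (m j) (mon_lcm (m ` (J - {j})))"
    using assms j dvd_mon_lcm[of "m ` (J - {j})"] by blast
  also have "\<not> \<dots> \<longleftrightarrow> (\<exists>x. 0 < Poly_Mapping.lookup (m j) x \<and>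
      (\<forall>i\<in>J - {j}. Poly_Mapping.lookup (m i) x < Poly_Mapping.lookup (m j) x))"
    using assms by (simp add: mon_dvd_iff lookup_mon_lcm not_le)
  finally show "(\<exists>x. 0 < Poly_Mapping.lookup (m j) x \<and>
      (\<forall>i\<in>J - {j}. Poly_Mapping.lookup (m i) x < Poly_Mapping.lookup (m j) x)) \<longleftrightarrow>
      \<not> mon_dvd (mon_lcm (m ` J)) (mon_lcm (m ` (J - {j})))" by blast
qed

lemma strictly_dominant_subset: "strictly_dominant J m \<Longrightarrow> I \<subseteq> J \<Longrightarrow> strictly_dominant I m"
  unfolding strictly_dominant_def by (fast dest: subsetD)

text \<open>Strict dominance passes to the index set of \<open>\<sigma>\<close>, so every deletion
  contributes a signed monomial other than 1. Any row of the column then lies in the ideal of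
  polynomials without constant term, whichever deletions contribute to it.\<close>

lemma taylor_entry_not_unit:
  assumes "strictly_dominant {1..q} m" "\<sigma> \<in> taylor_symbols q s"
  shows "\<not> Poly_Mapping.lookup (taylor_bd m \<sigma> :: nat list \<Rightarrow>\<^sub>0 ('x::finite, 'k::field) mpoly) \<rho> dvd 1"
proof (rule not_dvd_1_if_nonconstant)
  interpret module "(*) :: ('x, 'k) mpoly \<Rightarrow> _ \<Rightarrow> _" by (rule module_mult)
  have \<sigma>: "distinct \<sigma>" "strictly_dominant (set \<sigma>) m"
    using assms strictly_dominant_subset by (auto simp: taylor_symbols_def strict_sorted_iff)
  show "Poly_Mapping.lookup (taylor_bd m \<sigma> :: nat list \<Rightarrow>\<^sub>0 ('x, 'k) mpoly) \<rho>
      \<in> ideal_gen (monom ` (- {0}))"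
    unfolding taylor_bd_def lookup_sum ideal_gen_def
  proof (rule span_sum)
    fix j assume j: "j \<in> {..<length \<sigma>}"
    let ?a = "mon_lcm (m ` set \<sigma>) - mon_lcm (m ` set (delete_nth j \<sigma>))"
    have "?a \<noteq> 0"
      using \<sigma> j by (simp add: strictly_dominant_iff_lcm set_delete_nth mon_minus_eq_0_iff)
    then have "(- 1) ^ j * monom ?a \<in> span (monom ` (- {0}))"
      by (intro span_scale span_base) simp
    then show "Poly_Mapping.lookup (Poly_Mapping.single (delete_nth j \<sigma>) ((- 1) ^ j * monom ?a)) \<rho>
        \<in> span (monom ` (- {0}))"
      by (cases "delete_nth j \<sigma> = \<rho>") (auto simp: lookup_single span_zero)
  qed
qed

text \<open>Different positions delete different indices and give different faces, so exactly one
  summand contributes to this entry.\<close>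

lemma lookup_taylor_bd_delete_nth:
  assumes "distinct \<sigma>" "j < length \<sigma>"
  shows "Poly_Mapping.lookup (taylor_bd m \<sigma>) (delete_nth j \<sigma>) =
    (- 1) ^ j * monom (mon_lcm (m ` set \<sigma>) - mon_lcm (m ` set (delete_nth j \<sigma>)))"
proof -
  have "delete_nth k \<sigma> = delete_nth j \<sigma> \<longleftrightarrow> k = j" if "k < length \<sigma>" for k
    using set_delete_nth[OF assms(1)] assms that
    by (metis Diff_iff insertI1 nth_eq_iff_index_eq nth_mem singletonD)
  then have "Poly_Mapping.lookup (taylor_bd m \<sigma>) (delete_nth j \<sigma>) =
    (\<Sum>k<length \<sigma>. if k = j then (- 1) ^ k *
      monom (mon_lcm (m ` set \<sigma>) - mon_lcm (m ` set (delete_nth k \<sigma>))) else 0)"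
    unfolding taylor_bd_def lookup_sum
    by (intro sum.cong) (simp_all add: lookup_single when_def)
  then show ?thesis using assms(2) by simp
qed

lemma minimal_taylor_resolution_iff:
  fixes m :: "nat \<Rightarrow> 'x::finite mon"
  shows "minimal_free_resolution (taylor_resolution q m)
      (ideal_gen (monom ` m ` {1..q}) :: ('x, 'k::field) mpoly set) \<longleftrightarrow>
    strictly_dominant {1..q} m" (is "?L \<longleftrightarrow> ?R")
proof
  assume R: ?R
  show ?L
    unfolding minimal_free_resolution_def
  proof (intro conjI allI ballI)
    show "free_resolution (taylor_resolution q m)
        (ideal_gen (monom ` m ` {1..q}) :: ('x, 'k) mpoly set)"
      by (rule taylor_free_resolution)
  next
    fix s \<sigma> \<rho>
    assume "\<sigma> \<in> basis (taylor_resolution q m :: (nat list, ('x, 'k) mpoly) based_complex) (Suc s)"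
    then show "\<not> Poly_Mapping.lookup
        (bd (taylor_resolution q m :: (nat list, ('x, 'k) mpoly) based_complex) (Suc s) \<sigma>) \<rho> dvd 1"
      unfolding taylor_resolution_def using taylor_entry_not_unit[OF R] by simp
  qed
next
  assume L: ?L
  show ?R
  proof (subst strictly_dominant_iff_lcm, simp, intro ballI notI)
    fix i assume i: "i \<in> {1..q}"
      and dvd: "mon_dvd (mon_lcm (m ` {1..q})) (mon_lcm (m ` ({1..q} - {i})))"
    define \<sigma> where "\<sigma> = [1..<Suc q]"
    \<comment> \<open>Indices start at 1, list positions at 0.\<close>
    define j where "j = i - 1"
    have \<sigma>: "distinct \<sigma>" "j < length \<sigma>" "\<sigma> ! j = i" "set \<sigma> = {1..q}"
      using i by (auto simp: \<sigma>_def j_def simp del: upt_Suc)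
    \<comment> \<open>The existence of \<open>i\<close> gives \<open>q \<ge> 1\<close>, so
      \<open>Suc (q - 1)\<close> is \<open>q\<close>.\<close>
    have "\<sigma> \<in> taylor_symbols q (Suc (q - 1))"
      using i by (simp add: taylor_symbols_def \<sigma>_def atLeastLessThanSuc_atLeastAtMost del: upt_Suc)
    moreover from this have "delete_nth j \<sigma> \<in> taylor_symbols q (q - 1)"
      using \<sigma>(2) by (intro delete_nth_in_taylor_symbols) (auto simp: taylor_symbols_def)
    ultimately have "\<not> Poly_Mapping.lookup (taylor_bd m \<sigma> :: nat list \<Rightarrow>\<^sub>0 ('x, 'k) mpoly)
        (delete_nth j \<sigma>) dvd 1"
      using L unfolding minimal_free_resolution_def taylor_resolution_def by simp
    moreover have "mon_lcm (m ` set \<sigma>) - mon_lcm (m ` set (delete_nth j \<sigma>)) = 0"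
      unfolding mon_minus_eq_0_iff set_delete_nth[OF \<sigma>(1,2)] \<sigma>(3,4) by (rule dvd)
    ultimately show False
      unfolding lookup_taylor_bd_delete_nth[OF \<sigma>(1,2)]
      by (cases "even j") (simp_all add: monom_def)
  qed
qed

subsection \<open>Order of dominance\<close>

lemma length_dominance_seqs_le:
  assumes "finite G" "vs \<in> dominance_seqs G"
  shows "length vs \<le> card G"
proof -
  obtain ds where "distinct ds" "length ds = length vs" "set ds \<subseteq> G"
    using assms(2) by (auto simp: dominance_seqs_def)
  then show ?thesis using card_mono[OF assms(1)] by (metis distinct_card)
qed

lemma finite_length_dominance_seqs: "finite G \<Longrightarrow> finite (length ` dominance_seqs G)"
  by (rule finite_subset[of _ "{..card G}"]) (auto intro: length_dominance_seqs_le)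

lemma mon_lcm_singleton: "mon_lcm {a} = a"
  by (rule poly_mapping_eqI) (simp add: lookup_mon_lcm)

lemma single_dvd_iff:
  "mon_dvd (Poly_Mapping.single x n) a \<longleftrightarrow> n \<le> Poly_Mapping.lookup a x"
  by (auto simp: mon_dvd_iff lookup_single when_def)

text \<open>This makes the maximum in \<open>odom\<close> meaningful. A singleton \<open>{a}\<close>
  is dominant vacuously in any variable, and by minimality \<open>a\<close> is the only generator
  dividing its lcm.\<close>

lemma dominance_seqs_nonempty:
  assumes "A \<noteq> {}"
  shows "dominance_seqs (mon_minimals A) \<noteq> {}"
proof -
  obtain a where a: "a \<in> mon_minimals A"
    using assms exists_mon_minimal_dvd by blast
  have "[x] \<in> dominance_seqs (mon_minimals A)" for x
    unfolding dominance_seqs_def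
  proof (intro CollectI conjI exI[of _ "[a]"])
    show "\<forall>b\<in>mon_minimals A. mon_dvd b (mon_lcm (set [a])) \<longrightarrow> (\<exists>v\<in>set [x].
        mon_dvd (Poly_Mapping.single v (Poly_Mapping.lookup (mon_lcm (set [a])) v)) b)"
      using a by (auto simp: mon_minimals_def mon_lcm_singleton single_dvd_iff)
  qed (use a in \<open>auto simp: dominant_set_def dominant_in_def\<close>)
  then show ?thesis by blast
qed

lemma strictly_dominant_inj_on: "strictly_dominant J m \<Longrightarrow> inj_on m J"
  unfolding strictly_dominant_def by (rule inj_onI) (metis DiffI less_irrefl singletonD)

lemma strictly_dominant_mon_minimals:
  assumes "strictly_dominant J m"
  shows "mon_minimals (m ` J) = m ` J"
proof -
  have "m i = m j" if "i \<in> J" "j \<in> J" "mon_dvd (m i) (m j)" for i j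
    using assms that unfolding strictly_dominant_def mon_dvd_iff
    by (metis DiffI leD singletonD)
  then show ?thesis by (auto simp: mon_minimals_def)
qed

lemma exists_dominance_seq_if_strictly_dominant:
  fixes m :: "nat \<Rightarrow> 'x::{finite, linorder} mon"
  assumes dom: "strictly_dominant J m" and J: "finite J" "J \<noteq> {}"
  shows "\<exists>vs\<in>dominance_seqs (m ` J). length vs = card J"
proof -
  obtain v where v: "\<And>i j. j \<in> J \<Longrightarrow> i \<in> J \<Longrightarrow> i \<noteq> j \<Longrightarrow>
      Poly_Mapping.lookup (m i) (v j) < Poly_Mapping.lookup (m j) (v j)"
    using dom unfolding strictly_dominant_def by (metis DiffI singletonD)
  \<comment> \<open>Two generators cannot each strictly exceed the other in a shared
    variable.\<close>
  have inj_v: "inj_on v J"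
    by (rule inj_onI) (metis v less_asym)
  \<comment> \<open>A dominance sequence is increasing in the variables, so the variables are sorted
    and \<open>w\<close> lists the generators in the matching order.\<close>
  define w where "w = inv_into J v"
  define vs where "vs = sorted_list_of_set (v ` J)"
  define ds where "ds = map (\<lambda>x. m (w x)) vs"
  have vs: "set vs = v ` J" "distinct vs" "length vs = card J"
    using J inj_v by (simp_all add: vs_def card_image)
  have w: "w (v j) = j" if "j \<in> J" for j
    using that inj_v by (simp add: w_def)
  have wJ: "w ` v ` J = J" using w by force
  have ds: "set ds = m ` J"
    unfolding ds_def set_map vs(1) using wJ by (metis image_image)
  have "distinct ds"
    unfolding ds_def distinct_map
    using vs strictly_dominant_inj_on[OF dom] w by (auto simp: inj_on_def)
  have dom_ds: "dominant_in (m ` J) (m j) (v j)" if "j \<in> J" for j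
    using that v by (auto simp: dominant_in_def)
  have "vs \<in> dominance_seqs (m ` J)"
    unfolding dominance_seqs_def
  proof (intro CollectI conjI exI[of _ ds])
    show "vs \<noteq> []" using vs(1) J by auto
    show "sorted_wrt (<) vs" by (simp add: vs_def)
    show "dominant_set (set ds)" using J dom_ds by (auto simp: dominant_set_def ds)
    show "\<forall>k<length vs. dominant_in (set ds) (ds ! k) (vs ! k)"
    proof (intro allI impI)
      fix k assume k: "k < length vs"
      then have "vs ! k \<in> v ` J" unfolding vs(1)[symmetric] by (rule nth_mem)
      then obtain j where "j \<in> J" "vs ! k = v j" by blast
      then show "dominant_in (set ds) (ds ! k) (vs ! k)"
        using k w dom_ds unfolding ds by (simp add: ds_def)
    qed
    show "\<forall>a\<in>m ` J. mon_dvd a (mon_lcm (set ds)) \<longrightarrow> (\<exists>x\<in>set vs.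
        mon_dvd (Poly_Mapping.single x (Poly_Mapping.lookup (mon_lcm (set ds)) x)) a)"
    proof (intro ballI impI)
      fix a assume "a \<in> m ` J"
      then obtain j where j: "j \<in> J" "a = m j" by blast
      \<comment> \<open>Each generator attains the exponent of the lcm in its own dominant variable,
        which is the second condition on a dominance sequence.\<close>
      have "Poly_Mapping.lookup (m i) (v j) \<le> Poly_Mapping.lookup (m j) (v j)" if "i \<in> J" for i
        using v[OF j(1) that] by (cases "i = j") auto
      then have "Poly_Mapping.lookup (mon_lcm (m ` J)) (v j) \<le> Poly_Mapping.lookup (m j) (v j)"
        using J by (simp add: lookup_mon_lcm)
      then show "\<exists>x\<in>set vs.
          mon_dvd (Poly_Mapping.single x (Poly_Mapping.lookup (mon_lcm (set ds)) x)) a"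
        unfolding single_dvd_iff ds vs(1) using j by blast
    qed
    show "distinct ds" "length ds = length vs" "set ds \<subseteq> m ` J"
      using \<open>distinct ds\<close> ds by (simp_all add: ds_def)
  qed
  then show ?thesis using vs(3) by blast
qed

text \<open>The sequence requires \<open>card J\<close> distinct monomials inside the image of
  \<open>J\<close>. By counting they exhaust it and \<open>m\<close> is injective on
  \<open>J\<close>, so dominance among monomials becomes dominance among indices.\<close>

lemma strictly_dominant_if_dominance_seq:
  fixes m :: "nat \<Rightarrow> 'x::{finite, linorder} mon"
  assumes J: "finite J" and nz: "0 \<notin> m ` J" and G: "G \<subseteq> m ` J"
    and vs: "vs \<in> dominance_seqs G" "length vs = card J"
  shows "strictly_dominant J m"
proof -
  obtain ds where ds: "distinct ds" "length ds = length vs" "set ds \<subseteq> G" "dominant_set (set ds)"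
    using vs(1) by (auto simp: dominance_seqs_def)
  have "card (set ds) = card J" using ds vs(2) by (simp add: distinct_card)
  moreover have "card (m ` J) \<le> card J" using J by (rule card_image_le)
  moreover have sub: "set ds \<subseteq> m ` J" using ds G by blast
  ultimately have eq: "set ds = m ` J"
    using J by (intro card_seteq) auto
  then have inj: "inj_on m J"
    using J \<open>card (set ds) = card J\<close> by (intro eq_card_imp_inj_on) auto
  show ?thesis
    unfolding strictly_dominant_def
  proof
    fix j assume j: "j \<in> J"
    then obtain x where x: "dominant_in (m ` J) (m j) x"
      using ds(4) unfolding eq dominant_set_def by blast
    have less: "Poly_Mapping.lookup (m i) x < Poly_Mapping.lookup (m j) x" if "i \<in> J - {j}" for i
      using x that inj j by (auto simp: dominant_in_def inj_on_def)
    show "\<exists>x. 0 < Poly_Mapping.lookup (m j) x \<and>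
        (\<forall>i\<in>J - {j}. Poly_Mapping.lookup (m i) x < Poly_Mapping.lookup (m j) x)"
    \<comment> \<open>For a single generator dominance is vacuous, and a positive exponent comes
      from \<open>m j\<close> not being the monomial 1. Otherwise exceeding another exponent already
      forces positivity.\<close>
    proof (cases "J - {j} = {}")
      case True
      have "m j \<noteq> 0" using nz j by force
      then obtain y where "Poly_Mapping.lookup (m j) y \<noteq> 0"
        by (metis lookup_zero poly_mapping_eqI)
      then show ?thesis unfolding True by auto
    next
      case False
      then have "0 < Poly_Mapping.lookup (m j) x" using less by fastforce
      then show ?thesis using less by blast
    qed
  qed
qed

theorem theorem3p8:
  fixes M :: "('x::{finite, linorder}, 'k::field) mpoly set"
    and m :: "nat \<Rightarrow> 'x mon" and q :: nat
  assumes "M = ideal_gen (monom ` m ` {1..q})"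
    and "M \<noteq> {0}" and "M \<noteq> UNIV"
  shows "minimal_free_resolution (taylor_resolution q m) M \<longleftrightarrow> odom M = q"
proof -
  let ?J = "{1..q}"
  let ?G = "mon_minimals (m ` ?J)"
  have G: "min_mon_gens M = ?G"
    unfolding assms(1) by (rule min_mon_gens_ideal_gen)
  have "?G \<subseteq> m ` ?J" by (auto simp: mon_minimals_def)
  then have "finite ?G" using finite_subset by blast
  \<comment> \<open>The empty index set would generate the zero ideal.\<close>
  have J: "?J \<noteq> {}"
  proof
    assume "?J = {}"
    then have "M = {0}"
      unfolding assms(1) by (simp add: ideal_gen_def module.span_empty[OF module_mult])
    then show False using assms(2) by simp
  qed
  \<comment> \<open>The exponent vector 0 is the monomial 1, which would generate the unit
    ideal.\<close>
  have nz: "0 \<notin> m ` ?J"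
  proof
    assume "0 \<in> m ` ?J"
    moreover have "mon_dvd 0 u" for u :: "'x mon" by (simp add: mon_dvd_iff)
    ultimately have "p \<in> M" for p
      unfolding assms(1) in_ideal_gen_monom_iff by blast
    then show False using assms(3) by blast
  qed
  have "odom M = q \<longleftrightarrow> strictly_dominant ?J m"
  proof
    assume "strictly_dominant ?J m"
    then obtain vs where "vs \<in> dominance_seqs ?G" "length vs = q"
      using exists_dominance_seq_if_strictly_dominant[of ?J m] J
      by (auto simp: strictly_dominant_mon_minimals)
    moreover have "length us \<le> q" if "us \<in> dominance_seqs ?G" for us
    proof -
      have "length us \<le> card ?G"
        using \<open>finite ?G\<close> that by (rule length_dominance_seqs_le)
      also have "\<dots> \<le> card (m ` ?J)"
        using \<open>?G \<subseteq> m ` ?J\<close> by (intro card_mono) auto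
      also have "\<dots> \<le> q" using card_image_le[of ?J m] by simp
      finally show ?thesis .
    qed
    ultimately show "odom M = q"
      unfolding odom_def G
      by (intro Max_eqI finite_length_dominance_seqs \<open>finite ?G\<close>) auto
  next
    assume "odom M = q"
    moreover have "dominance_seqs ?G \<noteq> {}"
      using J by (intro dominance_seqs_nonempty) simp
    ultimately have "q \<in> length ` dominance_seqs ?G"
      using Max_in[OF finite_length_dominance_seqs[OF \<open>finite ?G\<close>]] by (auto simp: odom_def G)
    then obtain vs where "vs \<in> dominance_seqs ?G" "length vs = card ?J"
      by auto
    then show "strictly_dominant ?J m"
      using nz \<open>?G \<subseteq> m ` ?J\<close> by (intro strictly_dominant_if_dominance_seq[of ?J m ?G vs]) auto
  qed
  then show ?thesis
    unfolding assms(1) minimal_taylor_resolution_iff by simp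
qed

end
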